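(* Let $A\in\mathbb{R}^{n\times n}$ be invertible, let $U,V\in\mathbb{R}^{n\times k}$ have full column rank, assume $I+V^TA^{-1}U$ is invertible, and let $B=A+UV^T$. Let $\widetilde{A}^{-1}\in\mathbb{R}^{n\times n}$ and $Z^{-1}\in\mathbb{R}^{k\times k}$ be approximate inverses with errors $\epsilon_1=\|\widetilde{A}^{-1}-A^{-1}\|_2$ and $\epsilon_2=\|Z^{-1}-(I+V^T\widetilde{A}^{-1}U)^{-1}\|_2$, where $I+V^T\widetilde{A}^{-1}U$ is invertible, and let $\lambda=\|U\|_2\|V\|_2$. If $\|(I+V^TA^{-1}U)^{-1}\|_2\le\alpha$ and $$\epsilon_1<\frac{1}{2\lambda\alpha},$$ then $$\left\|B^{-1}-\left(\widetilde{A}^{-1}-\widetilde{A}^{-1}UZ^{-1}V^T\widetilde{A}^{-1}\right)\right\|_2\le \epsilon_1+\epsilon_1\lambda\alpha\left(2\|A^{-1}\|_2+\epsilon_1\right)+\lambda\left(\|A^{-1}\|_2+\epsilon_1\right)^2\left(\epsilon_2+2\epsilon_1\lambda\alpha^2\right).$$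
   Context: $\|\cdot\|_2$ is the spectral norm and $I$ is the identity matrix of appropriate size. $\widetilde{A}^{-1}$ is a single symbol for a given $n\times n$ matrix (the computed approximation of $A^{-1}$), and $Z^{-1}$ is a single symbol for a given $k\times k$ matrix (the computed approximation of $(I+V^T\widetilde{A}^{-1}U)^{-1}$). *)

theory Defs
  imports "HOL-Analysis.Analysis"
begin

(* The library norm on real ^ 'n is Euclidean, so onorm is the operator 2-norm;
   the library norm on the matrix type itself would be the Frobenius norm. *)
definition spectral_norm :: "real ^ 'n ^ 'm \<Rightarrow> real" where
  "spectral_norm M = onorm (\<lambda>x. M *v x)"

end

theory Submission
  imports Defs
begin

text \<open>Write \<open>P = A\<^sup>-\<^sup>1\<close>, \<open>Q\<close> for its approximation, \<open>W = (I + V\<^sup>T P U)\<^sup>-\<^sup>1\<close> and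
  \<open>Y = (I + V\<^sup>T Q U)\<^sup>-\<^sup>1\<close>. By the Sherman--Morrison--Woodbury formula the error is
  \<open>(P - Q) - (P - Q) U W V\<^sup>T P - Q U W V\<^sup>T (P - Q) - Q U (W - Z) V\<^sup>T Q\<close>, so everything reduces to
  bounding \<open>W - Y = W V\<^sup>T (Q - P) U Y\<close>. Its norm is at most \<open>\<epsilon>1 lam \<alpha> \<parallel>Y\<parallel>\<close> with \<open>\<epsilon>1 lam \<alpha> < 1/2\<close>,
  which gives first \<open>\<parallel>Y\<parallel> \<le> 2 \<alpha>\<close> and then \<open>\<parallel>W - Y\<parallel> \<le> 2 \<epsilon>1 lam \<alpha>\<^sup>2\<close>.\<close>

lemma matrix_diff_ldistrib: "A ** (B - C) = A ** B - A ** C" for A :: "'a::ring_1^'n^'m"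
  by (vector matrix_matrix_mult_def sum_subtractf right_diff_distrib)

lemma matrix_diff_rdistrib: "(A - B) ** C = A ** C - B ** C" for A :: "'a::ring_1^'n^'m"
  by (vector matrix_matrix_mult_def sum_subtractf left_diff_distrib)

lemma matrix_add_rdistrib: "(A + B) ** C = A ** C + B ** C"
  by (vector matrix_matrix_mult_def sum.distrib distrib_right)

text \<open>\<open>matrix_inv\<close> is a Hilbert choice; invertibility supplies the witness that
  makes the chosen matrix a two-sided inverse.\<close>

lemma matrix_inv_mult:
  assumes "invertible A"
  shows "A ** matrix_inv A = mat 1" "matrix_inv A ** A = mat 1"
proof -
  have "A ** matrix_inv A = mat 1 \<and> matrix_inv A ** A = mat 1"
    using assms unfolding invertible_def matrix_inv_def by (rule someI_ex)
  then show "A ** matrix_inv A = mat 1" "matrix_inv A ** A = mat 1"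
    by auto
qed

text \<open>For square matrices over a field a right inverse is already two-sided, so checking a
  single product suffices.\<close>

lemma matrix_inv_eqI:
  fixes A C :: "'a::field^'n^'n"
  assumes "A ** C = mat 1"
  shows "invertible A" "matrix_inv A = C"
proof -
  show inv: "invertible A"
    using assms invertible_right_inverse by blast
  have "matrix_inv A = matrix_inv A ** (A ** C)"
    by (simp add: assms)
  also have "\<dots> = C"
    by (simp add: matrix_mul_assoc matrix_inv_mult[OF inv])
  finally show "matrix_inv A = C" .
qed

text \<open>The resolvent identity: expand the right-hand side and cancel each inverse against its
  matrix.\<close>

lemma matrix_inv_diff:
  fixes M N :: "'a::field^'n^'n"
  assumes "invertible M" "invertible N"
  shows "matrix_inv M - matrix_inv N = matrix_inv M ** (N - M) ** matrix_inv N"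
proof -
  have "matrix_inv M ** N ** matrix_inv N = matrix_inv M"
    by (simp add: matrix_mul_assoc[symmetric] matrix_inv_mult assms)
  then show ?thesis
    by (simp add: matrix_diff_ldistrib matrix_diff_rdistrib matrix_inv_mult assms)
qed

lemma sherman_morrison_woodbury:
  fixes A :: "'a::field^'n^'n" and U V :: "'a^'k^'n"
  assumes "invertible A" and "invertible (mat 1 + transpose V ** matrix_inv A ** U)"
  defines "W \<equiv> matrix_inv (mat 1 + transpose V ** matrix_inv A ** U)"
  shows "invertible (A + U ** transpose V)" (is "invertible ?B")
    and "matrix_inv (A + U ** transpose V)
      = matrix_inv A - matrix_inv A ** U ** W ** transpose V ** matrix_inv A" (is "_ = ?C")
proof -
  define P where "P = matrix_inv A"
  define T where "T = transpose V"
  have AP: "A ** P = mat 1"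
    using assms(1) by (simp add: P_def matrix_inv_mult)
  have "W + T ** P ** U ** W = mat 1"
    using matrix_inv_mult(1)[OF assms(2)]
    by (simp add: W_def P_def T_def matrix_add_rdistrib)
  \<comment> \<open>This relation turns the quadratic term
    \<open>U ** T ** P ** U ** W ** T ** P\<close> of the product below into
    \<open>U ** T ** P - U ** W ** T ** P\<close>, after which everything but \<open>mat 1\<close>
    cancels.\<close>
  then have TPUW: "T ** P ** U ** W = mat 1 - W"
    by (simp add: algebra_simps)
  have "A ** (P ** U ** W ** T ** P) = U ** W ** T ** P"
    by (simp add: matrix_mul_assoc AP)
  moreover have "U ** T ** (P ** U ** W ** T ** P) = U ** (T ** P ** U ** W) ** T ** P"
    by (simp add: matrix_mul_assoc)
  ultimately have "(A + U ** T) ** (P - P ** U ** W ** T ** P) = mat 1"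
    unfolding TPUW by (simp add: matrix_diff_ldistrib matrix_diff_rdistrib matrix_add_rdistrib AP)
  then have eq: "?B ** ?C = mat 1"
    by (simp add: P_def T_def)
  show "invertible ?B" "matrix_inv ?B = ?C"
    using matrix_inv_eqI[OF eq] by auto
qed

lemma spectral_norm_nonneg: "0 \<le> spectral_norm M"
  by (simp add: spectral_norm_def onorm_pos_le)

lemma spectral_norm_mult: "spectral_norm (M ** N) \<le> spectral_norm M * spectral_norm N"
  using onorm_compose[of "(*v) M" "(*v) N"]
  by (simp add: spectral_norm_def o_def matrix_vector_mul_assoc)

lemma spectral_norm_add: "spectral_norm (M + N) \<le> spectral_norm M + spectral_norm N"
  using onorm_triangle[of "(*v) M" "(*v) N"]
  by (simp add: spectral_norm_def matrix_vector_mult_add_rdistrib)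

lemma spectral_norm_minus_commute: "spectral_norm (M - N) = spectral_norm (N - M)"
  using onorm_neg[of "\<lambda>x. (M - N) *v x"]
  by (simp add: spectral_norm_def matrix_vector_mult_diff_rdistrib[abs_def])

lemma spectral_norm_diff: "spectral_norm (M - N) \<le> spectral_norm M + spectral_norm N"
  using spectral_norm_add[of M "- N"] spectral_norm_minus_commute[of N 0] by simp

lemma spectral_norm_mult_mono:
  assumes "spectral_norm M \<le> a" "spectral_norm N \<le> b"
  shows "spectral_norm (M ** N) \<le> a * b"
  by (meson assms mult_mono' order_trans spectral_norm_mult spectral_norm_nonneg)

text \<open>Moving the transpose across the inner product and applying Cauchy-Schwarz bounds the
  square of \<open>norm ?y\<close> by a multiple of \<open>norm ?y\<close>, and one factor
  cancels.\<close>

lemma spectral_norm_transpose_le: "spectral_norm (transpose M) \<le> spectral_norm M"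
  unfolding spectral_norm_def
proof (rule onorm_bound)
  show "0 \<le> onorm ((*v) M)"
    by (simp add: onorm_pos_le)
  fix x
  let ?y = "transpose M *v x"
  have "(norm ?y)\<^sup>2 = x \<bullet> (M *v ?y)"
    by (simp add: power2_norm_eq_inner dot_lmul_matrix)
  also have "\<dots> \<le> norm x * norm (M *v ?y)"
    by (rule norm_cauchy_schwarz)
  also have "\<dots> \<le> norm x * (onorm ((*v) M) * norm ?y)"
    by (intro mult_left_mono onorm) auto
  finally have "norm ?y * norm ?y \<le> (onorm ((*v) M) * norm x) * norm ?y"
    by (simp add: power2_eq_square ac_simps)
  then show "norm ?y \<le> onorm ((*v) M) * norm x"
    by (cases "norm ?y = 0") (auto simp: onorm_pos_le mult_le_cancel_right)
qed

theorem mainTheorem1: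
  fixes A B Atilde :: "real ^ 'n ^ 'n"
    and U V :: "real ^ 'k ^ 'n"
    and Z :: "real ^ 'k ^ 'k"
    and \<epsilon>1 \<epsilon>2 lam \<alpha> :: real
  assumes "invertible A"
    and "rank U = CARD('k)"
    and "rank V = CARD('k)"
    and "invertible (mat 1 + transpose V ** matrix_inv A ** U)"
    and "B = A + U ** transpose V"
    and "\<epsilon>1 = spectral_norm (Atilde - matrix_inv A)"
    and "invertible (mat 1 + transpose V ** Atilde ** U)"
    and "\<epsilon>2 = spectral_norm (Z - matrix_inv (mat 1 + transpose V ** Atilde ** U))"
    and "lam = spectral_norm U * spectral_norm V"
    and "spectral_norm (matrix_inv (mat 1 + transpose V ** matrix_inv A ** U)) \<le> \<alpha>"
    and "\<epsilon>1 < 1 / (2 * lam * \<alpha>)"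
  shows "invertible B \<and>
    spectral_norm (matrix_inv B - (Atilde - Atilde ** U ** Z ** transpose V ** Atilde))
      \<le> \<epsilon>1 + \<epsilon>1 * lam * \<alpha> * (2 * spectral_norm (matrix_inv A) + \<epsilon>1)
        + lam * (spectral_norm (matrix_inv A) + \<epsilon>1)\<^sup>2 * (\<epsilon>2 + 2 * \<epsilon>1 * lam * \<alpha>\<^sup>2)"
proof -
  define P where "P = matrix_inv A"
  define T where "T = transpose V"
  define W where "W = matrix_inv (mat 1 + T ** P ** U)"
  define Y where "Y = matrix_inv (mat 1 + T ** Atilde ** U)"
  define u where "u = spectral_norm U"
  define v where "v = spectral_norm V"
  define p where "p = spectral_norm P"
  define y where "y = spectral_norm Y"
  note defs = P_def T_def W_def Y_def
  have lam: "lam = u * v"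
    using assms(9) by (simp add: u_def v_def)
  have nonneg: "0 \<le> \<epsilon>1" "0 \<le> u" "0 \<le> v" "0 \<le> p" "0 \<le> y"
    by (simp_all add: assms(6) u_def v_def p_def y_def spectral_norm_nonneg)
  have W: "spectral_norm W \<le> \<alpha>"
    using assms(10) by (simp add: defs)
  then have "0 \<le> \<alpha>"
    using spectral_norm_nonneg order_trans by blast
  have U: "spectral_norm U \<le> u"
    by (simp add: u_def)
  have T: "spectral_norm T \<le> v"
    by (simp add: T_def v_def spectral_norm_transpose_le)
  have P: "spectral_norm P \<le> p"
    by (simp add: p_def)
  have QP: "spectral_norm (Atilde - P) \<le> \<epsilon>1"
    using assms(6) by (simp add: defs)
  then have PQ: "spectral_norm (P - Atilde) \<le> \<epsilon>1"
    by (simp add: spectral_norm_minus_commute)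
  have Q: "spectral_norm Atilde \<le> p + \<epsilon>1"
    using spectral_norm_add[of P "Atilde - P"] QP by (simp add: p_def)
  \<comment> \<open>If \<open>lam * \<alpha> = 0\<close>, the bound on \<open>\<epsilon>1\<close> reads \<open>\<epsilon>1 < 0\<close> because \<open>1 / 0 = 0\<close>.\<close>
  have small: "\<epsilon>1 * lam * \<alpha> \<le> 1 / 2"
  proof -
    have "0 < lam * \<alpha>"
      using assms(11) nonneg \<open>0 \<le> \<alpha>\<close> by (cases "lam * \<alpha> = 0") (auto simp: lam less_le)
    then show ?thesis
      using assms(11) by (simp add: field_simps)
  qed

  \<comment> \<open>The difference is linear in \<open>Atilde - P\<close>; this is how \<epsilon>1
    enters the estimate of \<open>W - Y\<close>.\<close>
  have "mat 1 + T ** Atilde ** U - (mat 1 + T ** P ** U) = T ** (Atilde - P) ** U"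
    by (simp add: matrix_diff_ldistrib matrix_diff_rdistrib)
  then have WY_eq: "W - Y = W ** (T ** (Atilde - P) ** U) ** Y"
    using matrix_inv_diff[OF assms(4) assms(7)] by (simp add: defs)
  have "spectral_norm (W - Y) \<le> \<alpha> * (v * \<epsilon>1 * u) * y"
    unfolding WY_eq by (intro spectral_norm_mult_mono W T QP U) (simp add: y_def)
  then have WY: "spectral_norm (W - Y) \<le> (\<epsilon>1 * lam * \<alpha>) * y"
    by (simp add: lam ac_simps)
  \<comment> \<open>The triangle inequality for \<open>Y = W - (W - Y)\<close> leaves
    \<open>y\<close> on both sides; its coefficient on the right is at most 1/2, so that term is
    absorbed on the left.\<close>
  have "y \<le> \<alpha> + (\<epsilon>1 * lam * \<alpha>) * y"
    using spectral_norm_diff[of W "W - Y"] W WY by (simp add: y_def)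
  moreover have "(\<epsilon>1 * lam * \<alpha>) * y \<le> 1 / 2 * y"
    by (intro mult_right_mono small nonneg)
  ultimately have "y \<le> 2 * \<alpha>"
    by simp
  then have "(\<epsilon>1 * lam * \<alpha>) * y \<le> (\<epsilon>1 * lam * \<alpha>) * (2 * \<alpha>)"
    using nonneg \<open>0 \<le> \<alpha>\<close> by (intro mult_left_mono) (auto simp: lam)
  with WY have "spectral_norm (W - Y) \<le> 2 * \<epsilon>1 * lam * \<alpha>\<^sup>2"
    by (simp add: power2_eq_square ac_simps)
  moreover have "spectral_norm (Y - Z) = \<epsilon>2"
    using assms(8) by (simp add: defs spectral_norm_minus_commute)
  ultimately have WZ: "spectral_norm (W - Z) \<le> \<epsilon>2 + 2 * \<epsilon>1 * lam * \<alpha>\<^sup>2"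
    using spectral_norm_add[of "W - Y" "Y - Z"] by simp

  have B: "invertible B" "matrix_inv B = P - P ** U ** W ** T ** P"
    using sherman_morrison_woodbury[OF assms(1,4)] by (simp_all add: assms(5) defs)
  \<comment> \<open>Telescoping from \<open>P ** U ** W ** T ** P\<close> to
    \<open>Atilde ** U ** Z ** T ** Atilde\<close>: replace the left \<open>P\<close>, then the
    right \<open>P\<close>, then \<open>W\<close>.\<close>
  let ?E1 = "(P - Atilde) ** U ** W ** T ** P"
  let ?E2 = "Atilde ** U ** W ** T ** (P - Atilde)"
  let ?E3 = "Atilde ** U ** (W - Z) ** T ** Atilde"
  have "matrix_inv B - (Atilde - Atilde ** U ** Z ** T ** Atilde)
      = (P - Atilde) - (?E1 + ?E2 + ?E3)"
    by (simp add: B matrix_diff_ldistrib matrix_diff_rdistrib)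
  also have "spectral_norm \<dots> \<le> spectral_norm (P - Atilde)
      + (spectral_norm ?E1 + spectral_norm ?E2 + spectral_norm ?E3)"
    using spectral_norm_diff[of "P - Atilde" "?E1 + ?E2 + ?E3"]
      spectral_norm_add[of "?E1 + ?E2" ?E3] spectral_norm_add[of ?E1 ?E2] by linarith
  \<comment> \<open>The factor \<open>P\<close> in \<open>?E1\<close> gives \<open>p\<close> and the
    factor \<open>Atilde\<close> in \<open>?E2\<close> gives \<open>p + \<epsilon>1\<close>;
    together they produce \<open>2 * p + \<epsilon>1\<close>.\<close>
  also have "\<dots> \<le> \<epsilon>1 + (\<epsilon>1 * u * \<alpha> * v * p + (p + \<epsilon>1) * u * \<alpha> * v * \<epsilon>1
      + (p + \<epsilon>1) * u * (\<epsilon>2 + 2 * \<epsilon>1 * lam * \<alpha>\<^sup>2) * v * (p + \<epsilon>1))"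
    by (intro add_mono spectral_norm_mult_mono PQ U W T P Q WZ)
  also have "\<dots> = \<epsilon>1 + \<epsilon>1 * lam * \<alpha> * (2 * p + \<epsilon>1)
      + lam * (p + \<epsilon>1)\<^sup>2 * (\<epsilon>2 + 2 * \<epsilon>1 * lam * \<alpha>\<^sup>2)"
    by (simp add: lam power2_eq_square algebra_simps)
  finally show ?thesis
    using B(1) by (simp add: p_def P_def T_def)
qed

end
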